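(* Let $F$ be a field of characteristic $0$ and $F[x]$ the algebra of polynomials in an indeterminate $x$ with coefficients in $F$. Let $\Delta$ be a finite connected graph with $|V(\Delta)|>1$, and let $\mathbf{A}_{\Delta,F}-x\mathbf{E}$ be the characteristic matrix of its adjacency matrix over $F$. Then every minor of order $|V(\Delta)|-1$ of the matrix $\mathbf{A}_{\Delta,F}-x\mathbf{E}$, regarded as an element of $F[x]$, is nonzero (and belongs to $\mathbb{Z}[x]\subseteq F[x]$). Consequently, the matrix $\mathbf{A}_{\Delta,F}-x\mathbf{E}$, regarded over the field $\mathbb{Q}(x)$, has an inverse, all entries of which are nonzero.
   Context: A graph is an undirected graph without loops or multiple edges, with vertex set $V(\Delta)$. $\mathbf{A}_{\Delta,F}$ is the matrix over $F$ with rows and columns indexed by $V(\Delta)$ whose $(u,v)$ entry is $1$ if $u$ and $v$ are adjacent and $0$ otherwise; $\mathbf{E}$ is the identity matrix. A minor of order $|V(\Delta)|-1$ is the determinant of a matrix obtained by deleting one (arbitrary) row and one (arbitrary) column. *)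

theory Defs
  imports
    "Jordan_Normal_Form.Determinant"
    "Graph_Theory.Digraph_Component"
begin

(* A simple undirected graph is the library's "graph": a finite digraph without loops or
   parallel arcs whose adjacency relation is symmetric.  Matrices of the library are indexed by
   {0..<n}, so the rows and columns are attached to the vertices by a list vs that enumerates
   the vertex set without repetition; row i and column i belong to the vertex vs ! i. *)

definition adjacency_mat :: "('v, 'e) pre_digraph \<Rightarrow> 'v list \<Rightarrow> 'a :: zero_neq_one mat" where
  "adjacency_mat G vs = mat (length vs) (length vs)
     (\<lambda>(i, j). if vs ! i \<rightarrow>\<^bsub>G\<^esub> vs ! j then 1 else 0)"

(* The sign is that of A - x E; the library's char_poly_matrix is x E - A. *)
definition characteristic_mat :: "'a :: comm_ring_1 mat \<Rightarrow> 'a poly mat" where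
  "characteristic_mat A = map_mat (\<lambda>a. [:a:]) A - [:0, 1:] \<cdot>\<^sub>m 1\<^sub>m (dim_row A)"

end

theory Submission
  imports Defs "Jordan_Normal_Form.Char_Poly"
begin

text \<open>
  The matrix \<open>xE - A\<close> has the formal inverse \<open>\<Sum>k. A^k / x^(k+1)\<close>,
  whose entry at \<open>(i, j)\<close> is the generating function of the numbers of walks from vertex
  \<open>i\<close> to vertex \<open>j\<close>, by length.  In a connected graph some such number is positive,
  and in characteristic 0 it stays nonzero in the field.  So every entry of the inverse is nonzero,
  and hence so is every entry of the adjugate, which up to sign are the minors in question.

  The proof truncates this series, so that it stays within polynomial matrices.  Let \<open>C\<close> be
  the adjugate of \<open>M = A - xE\<close> and \<open>p = det M\<close>.  Iterating \<open>C A = x C + p E\<close>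
  gives \<open>C A^m = x^m C + p S\<close>, where \<open>S\<close> is the sum of
  \<open>x^(m-1-k) A^k\<close> over \<open>k < m\<close>
  (lemma \<open>mult_pow_eq_if_mult_characteristic_mat_scalar\<close>).  If the entry of \<open>C\<close>
  at \<open>(i, j)\<close> vanished, then \<open>p S\<close> would have at \<open>(i, j)\<close> the same entry as
  \<open>C A^m\<close>, whose degree in \<open>x\<close> is bounded independently of \<open>m\<close>; but as
  soon as one power \<open>A^k\<close> is nonzero at \<open>(i, j)\<close>, the degree of \<open>p S\<close>
  there is at least \<open>m - 1 - k\<close>
  (lemma \<open>det_mat_delete_characteristic_mat_nonzero\<close>, for matrices over any integral domain).
  Powers of the adjacency matrix that are nonzero at a given place come from walks in
  \<open>adjacency_mat_pow_nonzero\<close>.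

  The minors are integral because the characteristic matrix is the image of the one over the
  integers, and the inverse over the field of fractions is the adjugate divided by \<open>p\<close>.
\<close>

section \<open>Minors of a characteristic matrix\<close>

lemma characteristic_mat_carrier [simp]:
  "A \<in> carrier_mat n n \<Longrightarrow> characteristic_mat A \<in> carrier_mat n n"
  by (auto simp: characteristic_mat_def)

lemma det_characteristic_mat_nonzero:
  fixes A :: "'a :: idom mat"
  assumes A: "A \<in> carrier_mat n n"
  shows "det (characteristic_mat A) \<noteq> 0"
proof -
  have "characteristic_mat A = (- 1) \<cdot>\<^sub>m char_poly_matrix A"
    using A by (intro eq_matI) (auto simp: characteristic_mat_def char_poly_matrix_def)
  then have "det (characteristic_mat A) = (- 1) ^ dim_col (char_poly_matrix A) * char_poly A"
    by (simp add: char_poly_def)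
  moreover have "char_poly A \<noteq> 0"
    using degree_monic_char_poly[OF A] by auto
  ultimately show ?thesis
    by simp
qed

text \<open>
  This is the truncated geometric series.  Since \<open>C A = x C + p E\<close>, each further factor
  \<open>A\<close> turns \<open>x^m C + p S\<close> into
  \<open>x^(m+1) C + p (x^m E + S A)\<close>.  It is stated for entries, as
  only one entry of \<open>C\<close> will be assumed to vanish.
\<close>

lemma mult_pow_eq_if_mult_characteristic_mat_scalar:
  fixes A :: "'a :: comm_ring_1 mat"
  assumes A: "A \<in> carrier_mat n n" and C: "C \<in> carrier_mat n n"
    and CM: "C * characteristic_mat A = p \<cdot>\<^sub>m 1\<^sub>m n"
    and i: "i < n" and j: "j < n"
  shows "(C * map_mat (\<lambda>a. [:a:]) (A ^\<^sub>m m)) $$ (i, j) =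
    monom 1 m * C $$ (i, j) + p * (\<Sum>k<m. monom ((A ^\<^sub>m k) $$ (i, j)) (m - 1 - k))"
  using j
proof (induction m arbitrary: j)
  case 0
  have "map_mat (\<lambda>a. [:a:]) (1\<^sub>m n) = (1\<^sub>m n :: 'a poly mat)"
    by (rule eq_matI) (auto simp: one_pCons)
  then show ?case
    using A C i 0 by simp
next
  case (Suc m)
  note j = \<open>j < n\<close>
  define K where "K = map_mat (\<lambda>a. [:a:]) A"
  have K: "K \<in> carrier_mat n n"
    using A by (simp add: K_def)
  have pow: "A ^\<^sub>m k \<in> carrier_mat n n" for k
    using A by simp
  have entry: "(X * Y) $$ (i, j) = (\<Sum>w<n. X $$ (i, w) * Y $$ (w, j))"
    if "X \<in> carrier_mat n n" "Y \<in> carrier_mat n n" for X Y :: "'b :: semiring_0 mat"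
    using that i j by (auto simp: scalar_prod_def lessThan_atLeast0)
  interpret const: comm_ring_hom "\<lambda>a::'a. [:a:]"
    by unfold_locales (auto simp: one_pCons)
  have CK: "(\<Sum>w<n. C $$ (i, w) * K $$ (w, j)) =
      monom 1 1 * C $$ (i, j) + p * monom ((A ^\<^sub>m 0) $$ (i, j)) 0"
  proof -
    have "characteristic_mat A = K - [:0, 1:] \<cdot>\<^sub>m 1\<^sub>m n"
      using A by (simp add: characteristic_mat_def K_def)
    then have "C * K - [:0, 1:] \<cdot>\<^sub>m C = p \<cdot>\<^sub>m 1\<^sub>m n"
      using CM C K by (simp add: mult_minus_distrib_mat[of _ n n _ n] mult_smult_distrib[of _ n n _ n])
    then have "(C * K - [:0, 1:] \<cdot>\<^sub>m C) $$ (i, j) = (p \<cdot>\<^sub>m 1\<^sub>m n) $$ (i, j)"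
      by simp
    then have "(C * K) $$ (i, j) - [:0, 1:] * C $$ (i, j) = p * (1\<^sub>m n) $$ (i, j)"
      using C K i j by simp
    then show ?thesis
      unfolding entry[OF C K] using A i j by (auto simp: monom_altdef algebra_simps)
  qed
  have "C * map_mat (\<lambda>a. [:a:]) (A ^\<^sub>m Suc m) = (C * map_mat (\<lambda>a. [:a:]) (A ^\<^sub>m m)) * K"
    using C pow[of m] A
    by (simp add: K_def const.mat_hom_mult[of _ n n _ n] assoc_mult_mat[of _ n n _ n _ n])
  then have "(C * map_mat (\<lambda>a. [:a:]) (A ^\<^sub>m Suc m)) $$ (i, j) =
      (\<Sum>w<n. (C * map_mat (\<lambda>a. [:a:]) (A ^\<^sub>m m)) $$ (i, w) * K $$ (w, j))"
    using entry[of "C * map_mat (\<lambda>a. [:a:]) (A ^\<^sub>m m)" K] C K pow[of m] by simp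
  also have "\<dots> = (\<Sum>w<n. monom 1 m * (C $$ (i, w) * K $$ (w, j)) +
      p * (\<Sum>k<m. monom ((A ^\<^sub>m k) $$ (i, w) * A $$ (w, j)) (m - 1 - k)))"
  proof (rule sum.cong, simp)
    fix w assume "w \<in> {..<n}"
    then have w: "w < n" by simp
    have "K $$ (w, j) = monom (A $$ (w, j)) 0"
      using A w j by (simp add: K_def monom_0)
    then show "(C * map_mat (\<lambda>a. [:a:]) (A ^\<^sub>m m)) $$ (i, w) * K $$ (w, j) =
        monom 1 m * (C $$ (i, w) * K $$ (w, j)) +
        p * (\<Sum>k<m. monom ((A ^\<^sub>m k) $$ (i, w) * A $$ (w, j)) (m - 1 - k))"
      unfolding Suc.IH[OF w] by (simp add: algebra_simps sum_distrib_left sum_distrib_right mult_monom)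
  qed
  also have "\<dots> = monom 1 m * (\<Sum>w<n. C $$ (i, w) * K $$ (w, j)) +
      p * (\<Sum>k<m. \<Sum>w<n. monom ((A ^\<^sub>m k) $$ (i, w) * A $$ (w, j)) (m - 1 - k))"
    by (subst sum.swap) (simp add: sum.distrib sum_distrib_left)
  also have "(\<Sum>k<m. \<Sum>w<n. monom ((A ^\<^sub>m k) $$ (i, w) * A $$ (w, j)) (m - 1 - k)) =
      (\<Sum>k<m. monom ((A ^\<^sub>m Suc k) $$ (i, j)) (m - 1 - k))"
    using entry[OF pow A] by (simp add: monom_sum)
  also have "monom 1 m * (\<Sum>w<n. C $$ (i, w) * K $$ (w, j)) +
        p * (\<Sum>k<m. monom ((A ^\<^sub>m Suc k) $$ (i, j)) (m - 1 - k)) =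
      monom 1 (Suc m) * C $$ (i, j) +
        p * (\<Sum>k<Suc m. monom ((A ^\<^sub>m k) $$ (i, j)) (Suc m - 1 - k))"
  proof -
    have 1: "monom 1 m * (monom 1 1 * c) = monom 1 (Suc m) * c" for c :: "'a poly"
      by (simp add: mult_monom flip: mult.assoc)
    have 2: "monom 1 m * (p * monom c 0) = p * monom c m" for c :: 'a
      by (simp add: mult_monom mult.left_commute)
    show ?thesis
      unfolding CK sum.lessThan_Suc_shift distrib_left 1 2 by (simp add: add.assoc)
  qed
  finally show ?case .
qed

text \<open>
  The row and column indices change places because the entry of the adjugate at
  \<open>(i, j)\<close> is the cofactor at \<open>(j, i)\<close>.
\<close>

lemma det_mat_delete_characteristic_mat_nonzero:
  fixes A :: "'a :: idom mat"
  assumes A: "A \<in> carrier_mat n n" and i: "i < n" and j: "j < n"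
    and k: "(A ^\<^sub>m k) $$ (i, j) \<noteq> 0"
  shows "det (mat_delete (characteristic_mat A) j i) \<noteq> 0"
proof
  define C where "C = adj_mat (characteristic_mat A)"
  define p where "p = det (characteristic_mat A)"
  have M: "characteristic_mat A \<in> carrier_mat n n"
    using A by simp
  have C: "C \<in> carrier_mat n n" and CM: "C * characteristic_mat A = p \<cdot>\<^sub>m 1\<^sub>m n"
    unfolding C_def p_def using adj_mat[OF M] by auto
  have "p \<noteq> 0"
    unfolding p_def by (rule det_characteristic_mat_nonzero[OF A])
  assume "det (mat_delete (characteristic_mat A) j i) = 0"
  then have C0: "C $$ (i, j) = 0"
    using M i j by (simp add: C_def adj_mat_def cofactor_def)
  define D where "D = Max ((\<lambda>w. degree (C $$ (i, w))) ` {..<n})"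
  have D: "degree (C $$ (i, w)) \<le> D" if "w < n" for w
    unfolding D_def using that by (intro Max_ge) auto
  \<comment> \<open>Large enough for \<open>m - 1 - k\<close> to exceed the degree bound \<open>D\<close>.\<close>
  define m where "m = D + k + 2"
  define s where "s = (\<Sum>l<m. monom ((A ^\<^sub>m l) $$ (i, j)) (m - 1 - l))"
  have "(C * map_mat (\<lambda>a. [:a:]) (A ^\<^sub>m m)) $$ (i, j) =
      (\<Sum>w<n. C $$ (i, w) * [:(A ^\<^sub>m m) $$ (w, j):])"
    using C A i j
    by (auto simp: scalar_prod_def lessThan_atLeast0 intro!: sum.cong)
  moreover have "degree \<dots> \<le> D"
  proof (rule degree_sum_le)
    fix w assume "w \<in> {..<n}"
    have "degree (C $$ (i, w) * [:(A ^\<^sub>m m) $$ (w, j):]) \<le>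
        degree (C $$ (i, w)) + degree [:(A ^\<^sub>m m) $$ (w, j):]"
      by (rule degree_mult_le)
    with D[of w] \<open>w \<in> {..<n}\<close>
    show "degree (C $$ (i, w) * [:(A ^\<^sub>m m) $$ (w, j):]) \<le> D"
      by simp
  qed simp
  ultimately have "degree (p * s) \<le> D"
    using mult_pow_eq_if_mult_characteristic_mat_scalar[OF A C CM i j, of m] C0
    by (simp add: s_def)
  have "coeff s (m - 1 - k) = (\<Sum>l<m. if l = k then (A ^\<^sub>m l) $$ (i, j) else 0)"
    unfolding s_def coeff_sum by (rule sum.cong) (auto simp: m_def)
  also have "\<dots> = (A ^\<^sub>m k) $$ (i, j)"
    by (simp add: m_def)
  finally have "coeff s (m - 1 - k) \<noteq> 0"
    using k by simp
  then have "s \<noteq> 0" and "m - 1 - k \<le> degree s"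
    by (auto intro: le_degree)
  with \<open>p \<noteq> 0\<close> \<open>degree (p * s) \<le> D\<close> show False
    by (simp add: degree_mult_eq m_def)
qed

section \<open>Powers of an adjacency matrix\<close>

lemma adjacency_mat_carrier [simp]:
  "adjacency_mat G vs \<in> carrier_mat (length vs) (length vs)"
  by (simp add: adjacency_mat_def)

text \<open>
  The entries of the powers count walks.  Over the natural numbers nothing cancels, so a walk can
  be extended by an arc while its count stays positive; the transfer to characteristic 0 is
  made afterwards.
\<close>

lemma (in wf_digraph) adjacency_mat_pow_pos:
  assumes "distinct vs" and "set vs = verts G"
    and i: "i < length vs" and "j < length vs"
    and "vs ! i \<rightarrow>\<^sup>*\<^bsub>G\<^esub> vs ! j"
  shows "\<exists>k. ((adjacency_mat G vs :: nat mat) ^\<^sub>m k) $$ (i, j) > 0"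
proof -
  define A where "A = (adjacency_mat G vs :: nat mat)"
  have A: "A \<in> carrier_mat (length vs) (length vs)"
    by (simp add: A_def)
  have "\<forall>j < length vs. vs ! j = v \<longrightarrow> (\<exists>k. (A ^\<^sub>m k) $$ (i, j) > 0)" if "vs ! i \<rightarrow>\<^sup>*\<^bsub>G\<^esub> v" for v
    using that
  proof (induction rule: reachable_induct)
    case base
    show ?case
    proof (intro allI impI)
      fix j assume "j < length vs" "vs ! j = vs ! i"
      then have "j = i"
        using \<open>distinct vs\<close> i by (simp add: nth_eq_iff_index_eq)
      then have "(A ^\<^sub>m 0) $$ (i, j) > 0"
        using A i by simp
      then show "\<exists>k. (A ^\<^sub>m k) $$ (i, j) > 0" ..
    qed
  next
    case (step x y)
    show ?case
    proof (intro allI impI)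
      fix j assume j: "j < length vs" "vs ! j = y"
      have "x \<in> set vs"
        using \<open>vs ! i \<rightarrow>\<^sup>*\<^bsub>G\<^esub> x\<close> \<open>set vs = verts G\<close>
        by (auto simp: reachable_def elim: rtrancl_on.cases)
      then obtain w where w: "w < length vs" "vs ! w = x"
        by (auto simp: in_set_conv_nth)
      then obtain k where k: "(A ^\<^sub>m k) $$ (i, w) > 0"
        using step.IH by blast
      have "0 < (A ^\<^sub>m k) $$ (i, w) * A $$ (w, j)"
        using k w j step.hyps by (simp add: A_def adjacency_mat_def)
      also have "\<dots> \<le> (\<Sum>w<length vs. (A ^\<^sub>m k) $$ (i, w) * A $$ (w, j))"
        using w by (intro member_le_sum) auto
      also have "\<dots> = (A ^\<^sub>m Suc k) $$ (i, j)"
        using pow_carrier_mat[OF A, of k] A i j by (auto simp: scalar_prod_def lessThan_atLeast0)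
      finally show "\<exists>k. (A ^\<^sub>m k) $$ (i, j) > 0" ..
    qed
  qed
  with assms show ?thesis
    by (simp add: A_def)
qed

lemma (in wf_digraph) adjacency_mat_pow_nonzero:
  assumes "distinct vs" and "set vs = verts G"
    and "i < length vs" and "j < length vs"
    and "vs ! i \<rightarrow>\<^sup>*\<^bsub>G\<^esub> vs ! j"
  shows "\<exists>k. ((adjacency_mat G vs :: 'k :: {semiring_char_0, comm_semiring_1} mat) ^\<^sub>m k) $$ (i, j) \<noteq> 0"
proof -
  let ?A = "adjacency_mat G vs :: nat mat"
  obtain k where k: "(?A ^\<^sub>m k) $$ (i, j) > 0"
    using adjacency_mat_pow_pos[OF assms] by blast
  interpret of_nat: semiring_hom "of_nat :: nat \<Rightarrow> 'k"
    by unfold_locales auto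
  have "adjacency_mat G vs = (map_mat of_nat ?A :: 'k mat)"
    by (rule eq_matI) (auto simp: adjacency_mat_def)
  then have "adjacency_mat G vs ^\<^sub>m k = (map_mat of_nat (?A ^\<^sub>m k) :: 'k mat)"
    by (simp add: of_nat.mat_hom_pow[OF adjacency_mat_carrier])
  then have "(adjacency_mat G vs ^\<^sub>m k) $$ (i, j) = (of_nat ((?A ^\<^sub>m k) $$ (i, j)) :: 'k)"
    using pow_carrier_mat[OF adjacency_mat_carrier[where ?'a = nat], of G vs k] assms(3,4)
    by (simp only: index_map_mat carrier_matD)
  with k show ?thesis
    by (intro exI[of _ k]) simp
qed

section \<open>Integrality and the inverse\<close>

lemma det_mat_delete_characteristic_mat_adjacency_integral:
  assumes "i < length vs" and "j < length vs"
  shows "det (mat_delete (characteristic_mat (adjacency_mat G vs :: 'a :: comm_ring_1 mat)) i j)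
    \<in> range (map_poly of_int :: int poly \<Rightarrow> 'a poly)"
proof -
  let ?M = "characteristic_mat (adjacency_mat G vs :: int mat)"
  have uminus: "map_poly of_int (- 1) = (- 1 :: 'a poly)"
    using of_int_poly_hom.hom_uminus[of 1] by simp
  have "mat_delete (characteristic_mat (adjacency_mat G vs :: 'a mat)) i j =
      map_mat (map_poly of_int) (mat_delete ?M i j)"
    using assms
    by (intro eq_matI)
      (auto simp: mat_delete_def characteristic_mat_def adjacency_mat_def of_int_poly_hom.hom_minus uminus)
  then have "det (mat_delete (characteristic_mat (adjacency_mat G vs :: 'a mat)) i j) =
      map_poly of_int (det (mat_delete ?M i j))"
    by (simp only: comm_ring_hom.hom_det[OF of_int_poly_hom.comm_ring_hom_axioms])
  then show ?thesis
    by blast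
qed

lemma inverse_over_fract_entries_nonzero:
  fixes M :: "'a :: idom mat"
  assumes M: "M \<in> carrier_mat n n" and "det M \<noteq> 0"
    and minors: "\<And>i j. i < n \<Longrightarrow> j < n \<Longrightarrow> det (mat_delete M i j) \<noteq> 0"
  shows "\<exists>B \<in> carrier_mat n n. inverts_mat (map_mat to_fract M) B \<and>
    inverts_mat B (map_mat to_fract M) \<and> (\<forall>i < n. \<forall>j < n. B $$ (i, j) \<noteq> 0)"
proof -
  interpret to_fract: comm_ring_hom "to_fract :: 'a \<Rightarrow> 'a fract"
    by unfold_locales auto
  define d where "d = to_fract (det M)"
  define C where "C = map_mat to_fract (adj_mat M)"
  define B where "B = inverse d \<cdot>\<^sub>m C"
  let ?M = "map_mat to_fract M"
  have d: "d \<noteq> 0"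
    using \<open>det M \<noteq> 0\<close> by (simp add: d_def)
  have scalar: "map_mat to_fract (det M \<cdot>\<^sub>m 1\<^sub>m n) = d \<cdot>\<^sub>m 1\<^sub>m n"
    by (rule eq_matI) (auto simp: d_def)
  note adj = adj_mat[OF M]
  have fM: "?M \<in> carrier_mat n n" and C: "C \<in> carrier_mat n n" and B: "B \<in> carrier_mat n n"
    using M adj(1) by (auto simp: C_def B_def)
  have MC: "?M * C = d \<cdot>\<^sub>m 1\<^sub>m n" and CM: "C * ?M = d \<cdot>\<^sub>m 1\<^sub>m n"
    unfolding C_def using to_fract.mat_hom_mult[OF M adj(1)] to_fract.mat_hom_mult[OF adj(1) M]
    by (simp_all add: adj(2,3) scalar)
  have unit: "inverse d \<cdot>\<^sub>m (d \<cdot>\<^sub>m 1\<^sub>m n) = 1\<^sub>m n"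
    using d by (intro eq_matI) auto
  have "?M * B = 1\<^sub>m n"
    unfolding B_def mult_smult_distrib[OF fM C] MC by (rule unit)
  moreover have "B * ?M = 1\<^sub>m n"
    unfolding B_def mult_smult_assoc_mat[OF C fM] CM by (rule unit)
  moreover have "B $$ (i, j) \<noteq> 0" if "i < n" "j < n" for i j
    using that d M minors[of j i] by (simp add: B_def C_def adj_mat_def cofactor_def)
  ultimately show ?thesis
    using B fM by (intro bexI[of _ B]) (auto simp: inverts_mat_def)
qed

theorem mainTheorem12:
  fixes \<Delta> :: "('v, 'e) pre_digraph" and vs :: "'v list"
  assumes "graph \<Delta>"
    and "Digraph_Component.connected \<Delta>"
    and "card (verts \<Delta>) > 1"
    and "distinct vs" and "set vs = verts \<Delta>"
  shows "(\<forall>i < card (verts \<Delta>). \<forall>j < card (verts \<Delta>).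
      det (mat_delete (characteristic_mat (adjacency_mat \<Delta> vs :: 'f :: field_char_0 mat)) i j) \<noteq> 0 \<and>
      det (mat_delete (characteristic_mat (adjacency_mat \<Delta> vs :: 'f mat)) i j)
        \<in> range (map_poly of_int :: int poly \<Rightarrow> 'f poly)) \<and>
    (\<exists>B \<in> carrier_mat (card (verts \<Delta>)) (card (verts \<Delta>)).
      inverts_mat (map_mat to_fract (characteristic_mat (adjacency_mat \<Delta> vs :: rat mat))) B \<and>
      inverts_mat B (map_mat to_fract (characteristic_mat (adjacency_mat \<Delta> vs :: rat mat))) \<and>
      (\<forall>i < card (verts \<Delta>). \<forall>j < card (verts \<Delta>). B $$ (i, j) \<noteq> 0))"
proof -
  interpret graph \<Delta> by fact
  have card: "card (verts \<Delta>) = length vs"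
    using assms(4,5) distinct_card by metis
  have "strongly_connected \<Delta>"
    using symmetric_connected_imp_strongly_connected[OF sym_arcs] assms(2) by simp
  then have reach: "vs ! i \<rightarrow>\<^sup>*\<^bsub>\<Delta>\<^esub> vs ! j" if "i < length vs" "j < length vs" for i j
    using that assms(5) nth_mem[of i vs] nth_mem[of j vs] by (auto simp: strongly_connected_def simp del: nth_mem)
  have minors: "det (mat_delete (characteristic_mat (adjacency_mat \<Delta> vs :: 'k :: field_char_0 mat)) i j) \<noteq> 0"
    if i: "i < length vs" and j: "j < length vs" for i j
  proof -
    obtain k where "((adjacency_mat \<Delta> vs :: 'k mat) ^\<^sub>m k) $$ (j, i) \<noteq> 0"
      using adjacency_mat_pow_nonzero[OF assms(4,5) j i reach[OF j i]] by blast
    then show ?thesis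
      using det_mat_delete_characteristic_mat_nonzero[OF adjacency_mat_carrier j i] by blast
  qed
  show ?thesis
    unfolding card
  proof (intro conjI allI impI)
    fix i j assume "i < length vs" and "j < length vs"
    then show "det (mat_delete (characteristic_mat (adjacency_mat \<Delta> vs :: 'f mat)) i j) \<noteq> 0"
      and "det (mat_delete (characteristic_mat (adjacency_mat \<Delta> vs :: 'f mat)) i j)
        \<in> range (map_poly of_int :: int poly \<Rightarrow> 'f poly)"
      by (rule minors, rule det_mat_delete_characteristic_mat_adjacency_integral)
  next
    show "\<exists>B \<in> carrier_mat (length vs) (length vs).
        inverts_mat (map_mat to_fract (characteristic_mat (adjacency_mat \<Delta> vs :: rat mat))) B \<and>
        inverts_mat B (map_mat to_fract (characteristic_mat (adjacency_mat \<Delta> vs :: rat mat))) \<and>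
        (\<forall>i < length vs. \<forall>j < length vs. B $$ (i, j) \<noteq> 0)"
      by (rule inverse_over_fract_entries_nonzero[OF
          characteristic_mat_carrier[OF adjacency_mat_carrier]
          det_characteristic_mat_nonzero[OF adjacency_mat_carrier] minors])
  qed
qed

end
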